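(* Let $n\ge 1$. (i) If $\{v_j\}_{j=1}^k$ is a unit tight frame in $\mathbb{R}^n$ and $\epsilon\le\frac{1}{\sqrt n}$, then for all $\delta_1,\dots,\delta_k\in\mathbb{R}^n$ with $\|\delta_j\|<\epsilon$ for every $j$, the family $\{v_j+\delta_j\}_{j=1}^k$ is a frame in $\mathbb{R}^n$. (ii) The bound $\frac{1}{\sqrt n}$ is optimal: for every $\epsilon>\frac1{\sqrt n}$ there exist a unit tight frame $\{v_j\}_{j=1}^k$ in $\mathbb{R}^n$ (for some $k$) and vectors $\delta_1,\dots,\delta_k\in\mathbb{R}^n$ with $\|\delta_j\|<\epsilon$ for every $j$ such that $\{v_j+\delta_j\}_{j=1}^k$ is not a frame in $\mathbb{R}^n$.
   Context: A finite family $\{x_j\}_{j=1}^k$ of vectors in $\mathbb{R}^n$ is a frame if there are constants $0<A\le B<\infty$ with $A\|x\|^2\le \sum_{j=1}^k|\langle x,x_j\rangle|^2\le B\|x\|^2$ for all $x\in\mathbb{R}^n$. It is tight if one can take $A=B$. A unit tight frame is a tight frame all of whose vectors have norm $1$. *)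

theory Defs
  imports "HOL-Analysis.Analysis"
begin

(* A family x_1, ..., x_k is a pair (k, x) with x :: nat => real ^ 'n; only the
   values x j with j in {1..k} matter, and repetitions are allowed. *)

definition frame_bounds :: "real \<Rightarrow> real \<Rightarrow> nat \<Rightarrow> (nat \<Rightarrow> real ^ 'n) \<Rightarrow> bool" where
  "frame_bounds A B k x \<longleftrightarrow> 0 < A \<and> A \<le> B \<and>
     (\<forall>y. A * (norm y)\<^sup>2 \<le> (\<Sum>j=1..k. \<bar>y \<bullet> x j\<bar>\<^sup>2) \<and>
          (\<Sum>j=1..k. \<bar>y \<bullet> x j\<bar>\<^sup>2) \<le> B * (norm y)\<^sup>2)"

definition is_frame :: "nat \<Rightarrow> (nat \<Rightarrow> real ^ 'n) \<Rightarrow> bool" where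
  "is_frame k x \<longleftrightarrow> (\<exists>A B. frame_bounds A B k x)"

definition tight_frame :: "nat \<Rightarrow> (nat \<Rightarrow> real ^ 'n) \<Rightarrow> bool" where
  "tight_frame k x \<longleftrightarrow> (\<exists>A. frame_bounds A A k x)"

definition unit_tight_frame :: "nat \<Rightarrow> (nat \<Rightarrow> real ^ 'n) \<Rightarrow> bool" where
  "unit_tight_frame k x \<longleftrightarrow> tight_frame k x \<and> (\<forall>j\<in>{1..k}. norm (x j) = 1)"

end

theory Submission
  imports Defs
begin

text \<open>
  Summing the tight frame identity over an orthonormal basis gives the frame constant
  \<open>k / n\<close>.  Minkowski's inequality for the sequences of inner products with \<open>y\<close> then
  bounds the perturbed family below by \<open>(sqrt (k / n) - s) * norm y\<close>, where \<open>s\<close> is the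
  \<open>l2\<close>-norm of the perturbation, and \<open>s < sqrt (k / n)\<close> when every vector moves by less
  than \<open>1 / sqrt n\<close>.  For optimality, project the standard basis onto the hyperplane orthogonal
  to the all-ones vector: each vector moves by exactly \<open>1 / sqrt n\<close>.
\<close>

text \<open>Double counting: the squares \<open>(b \<bullet> v j)\<^sup>2\<close> over all pairs of
  a basis vector \<open>b\<close> and an index \<open>j\<close> add up to
  \<open>CARD('n) * A\<close> one way and to \<open>k\<close> the other way.\<close>

lemma unit_tight_frame_sum:
  fixes v :: "nat \<Rightarrow> real ^ 'n"
  assumes "unit_tight_frame k v"
  shows "(\<Sum>j=1..k. (y \<bullet> v j)\<^sup>2) = real k / real CARD('n) * (norm y)\<^sup>2" and "k > 0"
proof -
  obtain A where A: "0 < A" "\<And>y. (\<Sum>j=1..k. (y \<bullet> v j)\<^sup>2) = A * (norm y)\<^sup>2"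
    using assms by (force simp: unit_tight_frame_def tight_frame_def frame_bounds_def
        intro: antisym)
  have unit: "(norm (v j))\<^sup>2 = 1" if "j \<in> {1..k}" for j
    using assms that by (simp add: unit_tight_frame_def)
  have "real CARD('n) * A = (\<Sum>b\<in>(Basis :: (real ^ 'n) set). \<Sum>j=1..k. (b \<bullet> v j)\<^sup>2)"
    by (simp add: A(2) del: One_nat_def)
  also have "\<dots> = (\<Sum>j=1..k. \<Sum>b\<in>Basis. (b \<bullet> v j)\<^sup>2)"
    by (rule sum.swap)
  also have "\<dots> = (\<Sum>j=1..k. (norm (v j))\<^sup>2)"
    unfolding power2_norm_eq_inner
    by (intro sum.cong refl, subst euclidean_inner)
      (simp add: power2_eq_square inner_commute)
  also have "\<dots> = real k"
    using unit by simp
  finally have "real CARD('n) * A = real k" .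
  then have "A = real k / real CARD('n)"
    by (simp add: field_simps)
  \<comment> \<open>An empty family would force \<open>A = 0\<close>, against
    \<open>0 < A\<close>.\<close>
  with A show "(\<Sum>j=1..k. (y \<bullet> v j)\<^sup>2) = real k / real CARD('n) * (norm y)\<^sup>2" "k > 0"
    by (auto intro: Nat.gr0I)
qed

text \<open>Termwise Cauchy-Schwarz. It serves both the upper frame bound of an arbitrary finite
  family and the estimate of the perturbation.\<close>

lemma L2_set_inner_le:
  "L2_set (\<lambda>j. y \<bullet> x j) S \<le> norm y * L2_set (\<lambda>j. norm (x j)) S"
proof -
  have "L2_set (\<lambda>j. y \<bullet> x j) S = L2_set (\<lambda>j. \<bar>y \<bullet> x j\<bar>) S"
    by (simp add: L2_set_def)
  also have "\<dots> \<le> L2_set (\<lambda>j. norm y * norm (x j)) S"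
    by (intro L2_set_mono Cauchy_Schwarz_ineq2) simp
  also have "\<dots> = norm y * L2_set (\<lambda>j. norm (x j)) S"
    by (simp add: L2_set_right_distrib)
  finally show ?thesis .
qed

text \<open>The upper bound is automatic for a finite family, so only a lower bound has to be
  supplied. It is stated without squares, the form in which Minkowski's inequality delivers
  it.\<close>

lemma is_frameI:
  fixes x :: "nat \<Rightarrow> real ^ 'n"
  assumes "0 < c" and lower: "\<And>y. c * norm y \<le> L2_set (\<lambda>j. y \<bullet> x j) {1..k}"
  shows "is_frame k x"
  unfolding is_frame_def frame_bounds_def
proof (intro exI conjI allI)
  let ?M = "L2_set (\<lambda>j. norm (x j)) {1..k}"
  \<comment> \<open>\<open>?M\<^sup>2\<close> already bounds the sum from above; adding
    \<open>c\<^sup>2\<close> makes the ordering of the two constants immediate.\<close>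
  show "0 < c\<^sup>2" "c\<^sup>2 \<le> c\<^sup>2 + ?M\<^sup>2"
    using \<open>0 < c\<close> by simp_all
  fix y :: "real ^ 'n"
  have eq: "(\<Sum>j=1..k. \<bar>y \<bullet> x j\<bar>\<^sup>2) = (L2_set (\<lambda>j. y \<bullet> x j) {1..k})\<^sup>2"
    by (simp add: L2_set_def sum_nonneg)
  have "(c * norm y)\<^sup>2 \<le> (L2_set (\<lambda>j. y \<bullet> x j) {1..k})\<^sup>2"
    using \<open>0 < c\<close> by (intro power_mono lower) simp
  then show "c\<^sup>2 * (norm y)\<^sup>2 \<le> (\<Sum>j=1..k. \<bar>y \<bullet> x j\<bar>\<^sup>2)"
    by (simp only: eq power_mult_distrib)
  have "(L2_set (\<lambda>j. y \<bullet> x j) {1..k})\<^sup>2 \<le> (norm y * ?M)\<^sup>2"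
    by (intro power_mono L2_set_inner_le) simp
  also have "\<dots> \<le> (c\<^sup>2 + ?M\<^sup>2) * (norm y)\<^sup>2"
    by (simp add: power_mult_distrib algebra_simps)
  finally show "(\<Sum>j=1..k. \<bar>y \<bullet> x j\<bar>\<^sup>2) \<le> (c\<^sup>2 + ?M\<^sup>2) * (norm y)\<^sup>2"
    by (simp only: eq)
qed

lemma unit_tight_frame_perturb:
  fixes v \<delta> :: "nat \<Rightarrow> real ^ 'n"
  assumes v: "unit_tight_frame k v"
    and \<delta>: "\<And>j. j \<in> {1..k} \<Longrightarrow> norm (\<delta> j) < 1 / sqrt (real CARD('n))"
  shows "is_frame k (\<lambda>j. v j + \<delta> j)"
proof -
  let ?c = "sqrt (real k / real CARD('n))"
  let ?s = "L2_set (\<lambda>j. norm (\<delta> j)) {1..k}"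
  have "k > 0"
    using unit_tight_frame_sum(2)[OF v] .
  \<comment> \<open>The \<open>k\<close> terms \<open>1 / n\<close> add up to exactly the frame
    constant \<open>k / n\<close>. Strictness survives summation because
    \<open>k > 0\<close>.\<close>
  have "(\<Sum>j=1..k. (norm (\<delta> j))\<^sup>2) < (\<Sum>j=1..k. 1 / real CARD('n))"
  proof (rule sum_strict_mono)
    fix j assume "j \<in> {1..k}"
    then have "(norm (\<delta> j))\<^sup>2 < (1 / sqrt (real CARD('n)))\<^sup>2"
      using \<delta> by (intro power_strict_mono) auto
    then show "(norm (\<delta> j))\<^sup>2 < 1 / real CARD('n)"
      by (simp add: power_divide)
  qed (use \<open>k > 0\<close> in auto)
  then have less: "?s < ?c"
    by (simp add: L2_set_def)
  have "(?c - ?s) * norm y \<le> L2_set (\<lambda>j. y \<bullet> (v j + \<delta> j)) {1..k}" for y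
  proof -
    have "?c * norm y = L2_set (\<lambda>j. y \<bullet> v j) {1..k}"
      unfolding L2_set_def unit_tight_frame_sum(1)[OF v] real_sqrt_mult by simp
    \<comment> \<open>Splitting \<open>v j\<close> as \<open>(v j + \<delta> j) - \<delta> j\<close>
      turns Minkowski into a lower bound for the perturbed family.\<close>
    also have "\<dots> = L2_set (\<lambda>j. y \<bullet> (v j + \<delta> j) + y \<bullet> (- \<delta> j)) {1..k}"
      by (simp add: inner_right_distrib)
    also have "\<dots> \<le> L2_set (\<lambda>j. y \<bullet> (v j + \<delta> j)) {1..k} + L2_set (\<lambda>j. y \<bullet> (- \<delta> j)) {1..k}"
      by (rule L2_set_triangle_ineq)
    also have "L2_set (\<lambda>j. y \<bullet> (- \<delta> j)) {1..k} \<le> norm y * ?s"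
      using L2_set_inner_le[of y "\<lambda>j. - \<delta> j"] by simp
    finally show ?thesis
      by (simp add: algebra_simps)
  qed
  with less show ?thesis
    by (intro is_frameI[of "?c - ?s"]) auto
qed

text \<open>At \<open>u\<close> the lower frame inequality would read
  \<open>A * (norm u)\<^sup>2 \<le> 0\<close>.\<close>

lemma not_is_frame_orthogonal:
  fixes x :: "nat \<Rightarrow> real ^ 'n"
  assumes "u \<noteq> 0" "\<And>j. j \<in> {1..k} \<Longrightarrow> u \<bullet> x j = 0"
  shows "\<not> is_frame k x"
proof
  assume "is_frame k x"
  then obtain A where "0 < A" "A * (norm u)\<^sup>2 \<le> (\<Sum>j=1..k. \<bar>u \<bullet> x j\<bar>\<^sup>2)"
    unfolding is_frame_def frame_bounds_def by blast
  moreover have "(\<Sum>j=1..k. \<bar>u \<bullet> x j\<bar>\<^sup>2) = 0"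
    using assms(2) by simp
  ultimately show False
    using \<open>u \<noteq> 0\<close> by (simp add: mult_le_0_iff)
qed

lemma exists_unit_tight_frame_perturb_not_frame:
  "\<exists>(v :: nat \<Rightarrow> real ^ 'n) \<delta>. unit_tight_frame CARD('n) v \<and>
     (\<forall>j. norm (\<delta> j) = 1 / sqrt (real CARD('n))) \<and>
     \<not> is_frame CARD('n) (\<lambda>j. v j + \<delta> j)"
proof -
  \<comment> \<open>Coordinates are indexed by the finite type \<open>'n\<close>, so a bijection
    numbers the standard basis.\<close>
  obtain f :: "nat \<Rightarrow> 'n" where f: "bij_betw f {1..CARD('n)} UNIV"
    using finite_same_card_bij[of "{1..CARD('n)}" "UNIV :: 'n set"] by auto
  define v :: "nat \<Rightarrow> real ^ 'n" where "v j = axis (f j) 1" for j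
  define u :: "real ^ 'n" where "u = 1"
  \<comment> \<open>Projecting along \<open>u\<close> subtracts
    \<open>(u \<bullet> v j) / (u \<bullet> u)\<close> times \<open>u\<close>. Here
    \<open>u \<bullet> v j = 1\<close> and \<open>u \<bullet> u = n\<close>, so all shifts coincide,
    with norm \<open>sqrt n / n\<close>.\<close>
  define \<delta> where "\<delta> j = - (1 / real CARD('n)) *\<^sub>R u" for j :: nat
  have norm_u: "norm u = sqrt (real CARD('n))"
    by (simp add: norm_eq_sqrt_inner inner_vec_def u_def)
  have "(\<Sum>j=1..CARD('n). \<bar>y \<bullet> v j\<bar>\<^sup>2) = (norm y)\<^sup>2" for y :: "real ^ 'n"
  proof -
    have "(\<Sum>j=1..CARD('n). \<bar>y \<bullet> v j\<bar>\<^sup>2) = (\<Sum>j=1..CARD('n). (y $ f j)\<^sup>2)"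
      by (simp add: v_def inner_axis)
    also have "\<dots> = (\<Sum>i\<in>UNIV. (y $ i)\<^sup>2)"
      by (rule sum.reindex_bij_betw[OF f])
    also have "\<dots> = (norm y)\<^sup>2"
      unfolding power2_norm_eq_inner by (simp add: inner_vec_def power2_eq_square)
    finally show ?thesis .
  qed
  then have "frame_bounds 1 1 CARD('n) v"
    by (simp add: frame_bounds_def)
  then have "unit_tight_frame CARD('n) v"
    by (auto simp: unit_tight_frame_def tight_frame_def v_def)
  moreover have "norm (\<delta> j) = 1 / sqrt (real CARD('n))" for j
    by (simp add: \<delta>_def norm_u field_simps)
  moreover have "\<not> is_frame CARD('n) (\<lambda>j. v j + \<delta> j)"
  proof (rule not_is_frame_orthogonal)
    show "u \<noteq> 0"
      by (simp add: u_def)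
    have "u \<bullet> v j = 1" for j
      by (simp add: u_def v_def inner_axis)
    moreover have "u \<bullet> u = real CARD('n)"
      by (simp add: u_def inner_vec_def)
    ultimately show "u \<bullet> (v j + \<delta> j) = 0" for j
      by (simp add: \<delta>_def inner_diff_right)
  qed
  ultimately show ?thesis
    by blast
qed

theorem corollary4p1p1:
  shows
    "(\<forall>(k::nat) (v :: nat \<Rightarrow> real ^ 'n) (\<epsilon>::real).
        unit_tight_frame k v \<longrightarrow> \<epsilon> \<le> 1 / sqrt (real CARD('n)) \<longrightarrow>
        (\<forall>\<delta> :: nat \<Rightarrow> real ^ 'n. (\<forall>j\<in>{1..k}. norm (\<delta> j) < \<epsilon>) \<longrightarrow>
           is_frame k (\<lambda>j. v j + \<delta> j)))
     \<and>
     (\<forall>\<epsilon>::real. \<epsilon> > 1 / sqrt (real CARD('n)) \<longrightarrow>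
        (\<exists>(k::nat) (v :: nat \<Rightarrow> real ^ 'n) (\<delta> :: nat \<Rightarrow> real ^ 'n).
           unit_tight_frame k v \<and> (\<forall>j\<in>{1..k}. norm (\<delta> j) < \<epsilon>) \<and>
           \<not> is_frame k (\<lambda>j. v j + \<delta> j)))"
proof (intro conjI allI impI)
  fix k :: nat and v \<delta> :: "nat \<Rightarrow> real ^ 'n" and \<epsilon> :: real
  assume "unit_tight_frame k v" "\<epsilon> \<le> 1 / sqrt (real CARD('n))"
    and "\<forall>j\<in>{1..k}. norm (\<delta> j) < \<epsilon>"
  then show "is_frame k (\<lambda>j. v j + \<delta> j)"
    by (intro unit_tight_frame_perturb) (auto intro: less_le_trans)
next
  fix \<epsilon> :: real
  assume "\<epsilon> > 1 / sqrt (real CARD('n))"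
  then show "\<exists>(k::nat) (v :: nat \<Rightarrow> real ^ 'n) (\<delta> :: nat \<Rightarrow> real ^ 'n).
      unit_tight_frame k v \<and> (\<forall>j\<in>{1..k}. norm (\<delta> j) < \<epsilon>) \<and>
      \<not> is_frame k (\<lambda>j. v j + \<delta> j)"
    \<comment> \<open>One example serves every \<open>\<epsilon>\<close>, since its shifts have norm
      exactly \<open>1 / sqrt n\<close>.\<close>
    using exists_unit_tight_frame_perturb_not_frame[where 'n = 'n] by metis
qed

end
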